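(* (a) $\chi_1([1,1,1])\le P_1(1,1,1;2,2,2)=2$. (b) $\chi_1([2,1,1])\le P_1(2,1,1;6,2,2)=3$. (c) $\chi_1([a,1,1])\le P_1(a,1,1;2a,2,2)=4$ for all integers $a\ge 3$. (d) $\chi_1([2,2,1])\le P_1(2,2,1;10,10,2)=5$. (e) $\chi_1([a,2,1])\le P_1(a,2,1;2a,12,2)\le 6$ for all integers $a\ge 3$. (f) $\chi_1([a,3,1])\le P_1(a,3,1;2a,21,2)\le 7$ for all integers $a\ge 3$. (g) $\chi_1([a,4,1])\le P_1(a,4,1;2a,28,2)\le 7$ for all integers $a\ge 4$. (h) $\chi_1([a,b,c])\le P_1(a,b,c;2a,2b,2c)\le 8$ for all positive integers $a\ge b\ge c$.
   Context: For positive integers $a,b,c$, $\mathcal{CC}_1([a,b,c])=\{[x,x+a]\times[y,y+b]\times[z,z+c]: x,y,z\in\mathbb{Z}\}$; the cuboid $[x,x+a]\times[y,y+b]\times[z,z+c]$ has root $(x,y,z)$. Two cuboids touch if their interiors are disjoint and their intersection is a non-degenerate two-dimensional rectangle. A configuration is a finite subset of $\mathcal{CC}_1([a,b,c])$ with pairwise disjoint interiors, and its contact graph has the cuboids as vertices and edges between touching cuboids; $\chi_1([a,b,c])$ is the maximum chromatic number of such contact graphs. For positive integers $X,Y,Z$, $P_1(a,b,c;X,Y,Z)$ denotes the least $n$ for which there is a coloring $\kappa:\mathbb{Z}^3\to\{1,\dots,n\}$ of roots that is periodic with period $X\times Y\times Z$ (i.e. $\kappa(x+X,y,z)=\kappa(x,y+Y,z)=\kappa(x,y,z+Z)=\kappa(x,y,z)$)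 and such that any two touching cuboids of $\mathcal{CC}_1([a,b,c])$ with disjoint interiors have roots of different colors (so that $\kappa$ properly colors every configuration); $P_1(a,b,c;X,Y,Z)=\infty$ if no such coloring exists. *)

theory Defs
  imports "HOL-Analysis.Analysis" "HOL-Library.Extended_Nat"
begin

type_synonym point = "real \<times> real \<times> real"

definition cuboid :: "int \<Rightarrow> int \<Rightarrow> int \<Rightarrow> int \<times> int \<times> int \<Rightarrow> point set" where
  "cuboid a b c = (\<lambda>(x, y, z).
     {real_of_int x..real_of_int (x + a)} \<times>
     {real_of_int y..real_of_int (y + b)} \<times>
     {real_of_int z..real_of_int (z + c)})"

definition CC1 :: "int \<Rightarrow> int \<Rightarrow> int \<Rightarrow> point set set" where
  "CC1 a b c = range (cuboid a b c)"

(* Axis-parallel only: the intersection of two cuboids of CC1 is always an axis-parallel box. *)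
definition nondegenerate_rectangle :: "point set \<Rightarrow> bool" where
  "nondegenerate_rectangle S \<longleftrightarrow>
     (\<exists>x0 x1 y0 y1 z0 z1 :: real.
        S = {x0..x1} \<times> {y0..y1} \<times> {z0..z1} \<and>
        (x0 = x1 \<and> y0 < y1 \<and> z0 < z1 \<or>
         x0 < x1 \<and> y0 = y1 \<and> z0 < z1 \<or>
         x0 < x1 \<and> y0 < y1 \<and> z0 = z1))"

definition touch :: "point set \<Rightarrow> point set \<Rightarrow> bool" where
  "touch A B \<longleftrightarrow> interior A \<inter> interior B = {} \<and> nondegenerate_rectangle (A \<inter> B)"

definition configuration :: "int \<Rightarrow> int \<Rightarrow> int \<Rightarrow> point set set \<Rightarrow> bool" where
  "configuration a b c C \<longleftrightarrow>
     finite C \<and> C \<subseteq> CC1 a b c \<and> pairwise (\<lambda>A B. interior A \<inter> interior B = {}) C"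

definition contact_edges :: "point set set \<Rightarrow> point set set set" where
  "contact_edges C = {{A, B} |A B. A \<in> C \<and> B \<in> C \<and> touch A B}"

definition proper_coloring :: "'v set \<Rightarrow> 'v set set \<Rightarrow> nat \<Rightarrow> ('v \<Rightarrow> nat) \<Rightarrow> bool" where
  "proper_coloring V E n f \<longleftrightarrow>
     f \<in> V \<rightarrow> {1..n} \<and> (\<forall>u\<in>V. \<forall>v\<in>V. {u, v} \<in> E \<longrightarrow> f u \<noteq> f v)"

(* An infimum of a nonempty set of extended naturals is its least element; it is \<infinity> on the empty set. *)
definition chromatic_number :: "'v set \<Rightarrow> 'v set set \<Rightarrow> enat" where
  "chromatic_number V E = Inf {enat n |n. \<exists>f. proper_coloring V E n f}"

(* A finite supremum of a nonempty set of extended naturals is attained, hence a maximum;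
   the value \<infinity> would mean that the chromatic numbers are unbounded. *)
definition chi1 :: "int \<Rightarrow> int \<Rightarrow> int \<Rightarrow> enat" where
  "chi1 a b c = Sup {chromatic_number C (contact_edges C) |C. configuration a b c C}"

definition periodic :: "int \<Rightarrow> int \<Rightarrow> int \<Rightarrow> (int \<times> int \<times> int \<Rightarrow> nat) \<Rightarrow> bool" where
  "periodic X Y Z \<kappa> \<longleftrightarrow>
     (\<forall>x y z. \<kappa> (x + X, y, z) = \<kappa> (x, y, z) \<and>
              \<kappa> (x, y + Y, z) = \<kappa> (x, y, z) \<and>
              \<kappa> (x, y, z + Z) = \<kappa> (x, y, z))"

definition proper_root_coloring ::
    "int \<Rightarrow> int \<Rightarrow> int \<Rightarrow> nat \<Rightarrow> (int \<times> int \<times> int \<Rightarrow> nat) \<Rightarrow> bool" where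
  "proper_root_coloring a b c n \<kappa> \<longleftrightarrow>
     range \<kappa> \<subseteq> {1..n} \<and>
     (\<forall>r s. touch (cuboid a b c r) (cuboid a b c s) \<longrightarrow> \<kappa> r \<noteq> \<kappa> s)"

definition P1 :: "int \<Rightarrow> int \<Rightarrow> int \<Rightarrow> int \<Rightarrow> int \<Rightarrow> int \<Rightarrow> enat" where
  "P1 a b c X Y Z =
     Inf {enat n |n. \<exists>\<kappa>. proper_root_coloring a b c n \<kappa> \<and> periodic X Y Z \<kappa>}"

end

theory Submission
  imports Defs
begin

text \<open>
  In terms of roots, two cuboids touch iff one coordinate differs by exactly the side length and
  the other two differ by less. Every coloring below coarsens a single integer \<open>u\<close>,
  computed from the root, to \<open>(u div d) mod P\<close>; it is proper because touching roots have
  values of \<open>u\<close> at cyclic distance at least \<open>d\<close> modulo \<open>P * d\<close>.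
  For the lower bounds, (b) has a triangle and (d) a nine-vertex subgraph that needs five colors.
  In (c) with three colors, a row determines the colors of the neighbouring row so rigidly that
  a row would have to be constant.
\<close>

section \<open>Contact in terms of roots\<close>

text \<open>A nonempty product of closed intervals determines all its endpoints. The witnessing
  rectangle is nonempty, so the endpoints on both sides of the equation agree.\<close>

lemma nondegenerate_rectangle_Icc:
  "nondegenerate_rectangle ({l1..u1} \<times> {l2..u2} \<times> {l3..u3}) \<longleftrightarrow>
     l1 = u1 \<and> l2 < u2 \<and> l3 < u3 \<or>
     l1 < u1 \<and> l2 = u2 \<and> l3 < u3 \<or>
     l1 < u1 \<and> l2 < u2 \<and> l3 = u3"
proof
  assume "nondegenerate_rectangle ({l1..u1} \<times> {l2..u2} \<times> {l3..u3})"
  then obtain x0 x1 y0 y1 z0 z1 where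
    eq: "{l1..u1} \<times> {l2..u2} \<times> {l3..u3} = {x0..x1} \<times> {y0..y1} \<times> {z0..z1}" and
    r: "x0 = x1 \<and> y0 < y1 \<and> z0 < z1 \<or> x0 < x1 \<and> y0 = y1 \<and> z0 < z1 \<or>
        x0 < x1 \<and> y0 < y1 \<and> z0 = z1"
    unfolding nondegenerate_rectangle_def by blast
  have ne: "x0 \<le> x1" "y0 \<le> y1" "z0 \<le> z1"
    using r by auto
  then have "l1 = x0 \<and> u1 = x1 \<and> l2 = y0 \<and> u2 = y1 \<and> l3 = z0 \<and> u3 = z1"
    using eq by (simp add: times_eq_iff Icc_eq_Icc)
  with r show "l1 = u1 \<and> l2 < u2 \<and> l3 < u3 \<or> l1 < u1 \<and> l2 = u2 \<and> l3 < u3 \<or>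
     l1 < u1 \<and> l2 < u2 \<and> l3 = u3"
    by simp
qed (unfold nondegenerate_rectangle_def, blast)

text \<open>Two translates that meet share a box with side lengths
  \<open>a - \<bar>x - x'\<bar>\<close> and so on, so one vanishing and two positive sides is
  exactly the stated condition. A vanishing side already makes the interiors disjoint.\<close>

lemma touch_cuboid_iff:
  assumes "a \<ge> 1" "b \<ge> 1" "c \<ge> 1"
  shows "touch (cuboid a b c (x, y, z)) (cuboid a b c (x', y', z')) \<longleftrightarrow>
     \<bar>x - x'\<bar> = a \<and> \<bar>y - y'\<bar> < b \<and> \<bar>z - z'\<bar> < c \<or>
     \<bar>x - x'\<bar> < a \<and> \<bar>y - y'\<bar> = b \<and> \<bar>z - z'\<bar> < c \<or>
     \<bar>x - x'\<bar> < a \<and> \<bar>y - y'\<bar> < b \<and> \<bar>z - z'\<bar> = c" (is "_ \<longleftrightarrow> ?R")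
proof -
  let ?A = "cuboid a b c (x, y, z)" and ?B = "cuboid a b c (x', y', z')"
  have inter: "?A \<inter> ?B =
      {real_of_int (max x x')..real_of_int (min (x + a) (x' + a))} \<times>
      {real_of_int (max y y')..real_of_int (min (y + b) (y' + b))} \<times>
      {real_of_int (max z z')..real_of_int (min (z + c) (z' + c))}"
    by (auto simp: cuboid_def)
  have nondeg: "nondegenerate_rectangle (?A \<inter> ?B) \<longleftrightarrow> ?R"
    unfolding inter nondegenerate_rectangle_Icc of_int_less_iff of_int_eq_iff
    using assms by (smt (verit))
  have "interior ?A \<inter> interior ?B = {}" if ?R
    using that by (auto simp: cuboid_def interior_Times)
  with nondeg show ?thesis
    unfolding touch_def by blast
qed

lemma inj_cuboid:
  assumes "a \<ge> 1" "b \<ge> 1" "c \<ge> 1"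
  shows "inj (cuboid a b c)"
  using assms by (auto simp: inj_def cuboid_def times_eq_iff Icc_eq_Icc)

lemma touch_commute: "touch A B \<longleftrightarrow> touch B A"
  by (simp add: touch_def Int_commute)

section \<open>Root colorings and the two invariants\<close>

text \<open>A root coloring colors every configuration by giving each cuboid the color of its root,
  which is well defined because the cuboid determines its root. The number of colors does not depend
  on the configuration. If there is no coloring, the right-hand side is infinite.\<close>

lemma chi1_le_P1:
  assumes "a \<ge> 1" "b \<ge> 1" "c \<ge> 1"
  shows "chi1 a b c \<le> P1 a b c X Y Z"
proof -
  have "chromatic_number C (contact_edges C) \<le> enat n"
    if C: "configuration a b c C" and col: "proper_root_coloring a b c n \<kappa>" for C n \<kappa>
  proof -
    define f where "f = \<kappa> \<circ> inv (cuboid a b c)"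
    have f_cuboid: "f (cuboid a b c r) = \<kappa> r" for r
      by (simp add: f_def inv_f_f inj_cuboid assms)
    have sub: "C \<subseteq> range (cuboid a b c)"
      using C by (simp add: configuration_def CC1_def)
    have "f u \<noteq> f v" if "u \<in> C" "v \<in> C" "{u, v} \<in> contact_edges C" for u v
    proof -
      \<comment> \<open>An edge is an unordered pair, so the witnesses may come in the opposite
        order; symmetry of \<open>touch\<close> covers that.\<close>
      have "touch u v"
        using that(3) touch_commute by (auto simp: contact_edges_def doubleton_eq_iff)
      moreover obtain r s where "u = cuboid a b c r" "v = cuboid a b c s"
        using \<open>u \<in> C\<close> \<open>v \<in> C\<close> sub by (metis imageE subsetD)
      ultimately show ?thesis
        using col by (simp add: proper_root_coloring_def f_cuboid del: split_paired_All)
    qed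
    moreover have "f \<in> C \<rightarrow> {1..n}"
      using col by (auto simp: proper_root_coloring_def f_def)
    ultimately have "proper_coloring C (contact_edges C) n f"
      by (simp add: proper_coloring_def)
    then show ?thesis
      unfolding chromatic_number_def by (blast intro: Inf_lower)
  qed
  then show ?thesis
    unfolding chi1_def P1_def by (blast intro: Sup_least Inf_greatest)
qed

lemma P1_leI:
  assumes "proper_root_coloring a b c n \<kappa>" "periodic X Y Z \<kappa>"
  shows "P1 a b c X Y Z \<le> enat n"
  unfolding P1_def using assms by (blast intro: Inf_lower)

lemma P1_geI:
  assumes "\<And>n \<kappa>. proper_root_coloring a b c n \<kappa> \<Longrightarrow> m \<le> n"
  shows "enat m \<le> P1 a b c X Y Z"
  unfolding P1_def using assms by (auto intro!: Inf_greatest)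

lemma proper_root_coloringI:
  assumes "a \<ge> 1" "b \<ge> 1" "c \<ge> 1"
    and "\<And>r. \<kappa> r \<in> {1..n}"
    and "\<And>x y z x' y' z'. \<bar>x - x'\<bar> = a \<Longrightarrow> \<bar>y - y'\<bar> < b \<Longrightarrow> \<bar>z - z'\<bar> < c \<Longrightarrow>
           \<kappa> (x, y, z) \<noteq> \<kappa> (x', y', z')"
    and "\<And>x y z x' y' z'. \<bar>x - x'\<bar> < a \<Longrightarrow> \<bar>y - y'\<bar> = b \<Longrightarrow> \<bar>z - z'\<bar> < c \<Longrightarrow>
           \<kappa> (x, y, z) \<noteq> \<kappa> (x', y', z')"
    and "\<And>x y z x' y' z'. \<bar>x - x'\<bar> < a \<Longrightarrow> \<bar>y - y'\<bar> < b \<Longrightarrow> \<bar>z - z'\<bar> = c \<Longrightarrow>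
           \<kappa> (x, y, z) \<noteq> \<kappa> (x', y', z')"
  shows "proper_root_coloring a b c n \<kappa>"
  using assms by (fastforce simp: proper_root_coloring_def touch_cuboid_iff)

lemma proper_root_coloring_range:
  "proper_root_coloring a b c n \<kappa> \<Longrightarrow> 1 \<le> \<kappa> r \<and> \<kappa> r \<le> n"
  unfolding proper_root_coloring_def by (meson atLeastAtMost_iff range_subsetD)

lemma proper_root_coloring_neq:
  assumes "proper_root_coloring a b c n \<kappa>" "a \<ge> 1" "b \<ge> 1" "c \<ge> 1"
    and "\<bar>x - x'\<bar> = a \<and> \<bar>y - y'\<bar> < b \<and> \<bar>z - z'\<bar> < c \<or>
     \<bar>x - x'\<bar> < a \<and> \<bar>y - y'\<bar> = b \<and> \<bar>z - z'\<bar> < c \<or>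
     \<bar>x - x'\<bar> < a \<and> \<bar>y - y'\<bar> < b \<and> \<bar>z - z'\<bar> = c"
  shows "\<kappa> (x, y, z) \<noteq> \<kappa> (x', y', z')"
proof -
  have "touch (cuboid a b c (x, y, z)) (cuboid a b c (x', y', z'))"
    using assms by (simp only: touch_cuboid_iff)
  with assms(1) show ?thesis
    unfolding proper_root_coloring_def by blast
qed

section \<open>Block colorings\<close>

text \<open>The usual passage from a circular coloring, with values modulo \<open>P * d\<close> and
  required distance \<open>d\<close>, to an ordinary coloring with \<open>P\<close> colors. Adding 1
  moves the residues into \<open>{1..P}\<close>.\<close>

definition block_color :: "int \<Rightarrow> int \<Rightarrow> int \<Rightarrow> nat" where
  "block_color d P u = nat (1 + (u div d) mod P)"

lemma block_color_range:
  assumes "P > 0"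
  shows "block_color d P u \<in> {1..nat P}"
  using pos_mod_bound[OF assms, of "u div d"] pos_mod_sign[OF assms, of "u div d"]
  by (simp add: block_color_def le_nat_iff nat_le_iff)

lemma block_color_eq_iff:
  assumes "P > 0"
  shows "block_color d P u = block_color d P v \<longleftrightarrow> (u div d) mod P = (v div d) mod P"
proof -
  have "(u div d) mod P \<ge> 0" "(v div d) mod P \<ge> 0"
    using assms by simp_all
  then show ?thesis
    by (auto simp: block_color_def)
qed

lemma block_color_period:
  assumes "d > 0" "P * d dvd v - u"
  shows "block_color d P v = block_color d P u"
proof -
  from assms(2) obtain k where "v - u = P * d * k" ..
  then have "v = u + (k * P) * d"
    by (simp add: algebra_simps)
  then have "v div d = k * P + u div d"
    using assms(1) by simp
  then show ?thesis
    by (simp add: block_color_def)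
qed

text \<open>Equal colors would put \<open>u\<close> and \<open>v\<close> into blocks whose indices
  differ by a multiple of \<open>P\<close>, so \<open>v - u\<close> would be less than
  \<open>d\<close> away from a multiple of \<open>P * d\<close>. The range
  \<open>{d..P * d - d}\<close> excludes this.\<close>

lemma block_color_neq:
  assumes "d > 0" "P > 0" "d \<le> v - u" "v - u \<le> P * d - d"
  shows "block_color d P u \<noteq> block_color d P v"
proof
  assume "block_color d P u = block_color d P v"
  then have "P dvd v div d - u div d"
    using assms by (simp add: block_color_eq_iff mod_eq_dvd_iff dvd_diff_commute)
  then obtain k where k: "v div d - u div d = P * k" ..
  have "v = d * (v div d) + v mod d" "u = d * (u div d) + u mod d"
    by simp_all
  then have "v - u = d * (v div d - u div d) + (v mod d - u mod d)"
    by (simp add: algebra_simps)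
  then have e: "v - u = P * d * k + (v mod d - u mod d)"
    by (simp add: k ac_simps)
  have m: "0 \<le> v mod d" "v mod d < d" "0 \<le> u mod d" "u mod d < d"
    using assms by simp_all
  have Pb: "P * d > 0"
    using assms by simp
  have "P * d * k > 0"
    using e m assms by linarith
  then have "k > 0"
    using Pb zero_less_mult_pos by blast
  then have "P * d * 1 \<le> P * d * k"
    using Pb by (intro mult_left_mono) simp_all
  then show False
    using e m assms by linarith
qed

lemma block_color_neq_abs:
  assumes "d > 0" "P > 0" "d \<le> \<bar>u - v\<bar>" "\<bar>u - v\<bar> \<le> P * d - d"
  shows "block_color d P u \<noteq> block_color d P v"
proof (cases "u \<le> v")
  case True
  then show ?thesis using assms by (intro block_color_neq) auto
next
  case False
  then show ?thesis using assms by (intro block_color_neq[symmetric]) auto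
qed

text \<open>The common frame of all upper bounds: each case only has to supply \<open>u\<close>,
  \<open>d\<close> and \<open>P\<close>. Contacts are checked on the integer differences themselves,
  periods only modulo \<open>P * d\<close>.\<close>

lemma P1_le_block_color:
  fixes u :: "int \<Rightarrow> int \<Rightarrow> int \<Rightarrow> int"
  assumes abc: "a \<ge> 1" "b \<ge> 1" "c \<ge> 1" and d: "d > 0" "P > 0"
    and touch_x: "\<And>x y z x' y' z'. \<bar>x - x'\<bar> = a \<Longrightarrow> \<bar>y - y'\<bar> < b \<Longrightarrow> \<bar>z - z'\<bar> < c \<Longrightarrow>
           \<bar>u x y z - u x' y' z'\<bar> \<in> {d..P * d - d}"
    and touch_y: "\<And>x y z x' y' z'. \<bar>x - x'\<bar> < a \<Longrightarrow> \<bar>y - y'\<bar> = b \<Longrightarrow> \<bar>z - z'\<bar> < c \<Longrightarrow>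
           \<bar>u x y z - u x' y' z'\<bar> \<in> {d..P * d - d}"
    and touch_z: "\<And>x y z x' y' z'. \<bar>x - x'\<bar> < a \<Longrightarrow> \<bar>y - y'\<bar> < b \<Longrightarrow> \<bar>z - z'\<bar> = c \<Longrightarrow>
           \<bar>u x y z - u x' y' z'\<bar> \<in> {d..P * d - d}"
    and period: "\<And>x y z. P * d dvd u (x + X) y z - u x y z"
      "\<And>x y z. P * d dvd u x (y + Y) z - u x y z"
      "\<And>x y z. P * d dvd u x y (z + Z) - u x y z"
  shows "P1 a b c X Y Z \<le> enat (nat P)"
proof (rule P1_leI)
  define \<kappa> :: "int \<times> int \<times> int \<Rightarrow> nat" where
    "\<kappa> = (\<lambda>(x, y, z). block_color d P (u x y z))"
  have neq: "\<kappa> (x, y, z) \<noteq> \<kappa> (x', y', z')"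
    if "\<bar>u x y z - u x' y' z'\<bar> \<in> {d..P * d - d}" for x y z x' y' z'
    unfolding \<kappa>_def prod.case using that d by (intro block_color_neq_abs) auto
  have "\<kappa> r \<in> {1..nat P}" for r
    using block_color_range[OF d(2)] by (simp add: \<kappa>_def split: prod.splits)
  then show "proper_root_coloring a b c (nat P) \<kappa>"
    using abc touch_x touch_y touch_z by (intro proper_root_coloringI neq) auto
  show "periodic X Y Z \<kappa>"
    unfolding periodic_def \<kappa>_def prod.case using period d(1)
    by (intro allI conjI block_color_period)
qed

section \<open>Parities that detect a contact\<close>

text \<open>A translation by exactly \<open>a\<close> leads to the neighbouring block of length
  \<open>a\<close>, so the parity of the block index separates roots in contact along that
  axis.\<close>

lemma div_parity_shift:
  fixes a :: int
  assumes "a > 0" "\<bar>x - x'\<bar> = a"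
  shows "(x div a) mod 2 \<noteq> (x' div a) mod 2"
proof -
  have "x = x' + a \<or> x' = x + a"
    using assms by linarith
  then have "x div a = x' div a + 1 \<or> x' div a = x div a + 1"
    using assms(1) by auto
  moreover have "(k + 1) mod 2 \<noteq> k mod 2" for k :: int
    by presburger
  ultimately show ?thesis by metis
qed

lemma div_parity_period:
  fixes a :: int
  assumes "a > 0"
  shows "((x + 2 * a) div a) mod 2 = (x div a) mod 2"
  using assms by simp

lemma mod_2_cases: "k mod 2 = 0 \<or> k mod 2 = (1 :: int)"
  by presburger

text \<open>Meant for \<open>b = c = 1\<close>: a contact along the second or third axis fixes the
  other of these two coordinates and so flips the parity of \<open>y + z\<close>.\<close>

lemma add_parity_shift:
  fixes y :: int
  assumes "\<bar>y - y'\<bar> + \<bar>z - z'\<bar> = 1"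
  shows "\<bar>(y + z) mod 2 - (y' + z') mod 2\<bar> = 1"
proof -
  have "y + z = y' + z' + 1 \<or> y' + z' = y + z + 1"
    using assms by linarith
  moreover have "\<bar>(k + 1) mod 2 - k mod 2\<bar> = 1" "\<bar>k mod 2 - (k + 1) mod 2\<bar> = 1" for k :: int
    by presburger+
  ultimately show ?thesis
    by (elim disjE) (simp_all only:)
qed

section \<open>Bounds for the individual shapes\<close>

text \<open>The checkerboard coloring; a single contact forces two colors.\<close>

lemma P1_111: "P1 1 1 1 2 2 2 = 2"
proof (rule antisym)
  have "P1 1 1 1 2 2 2 \<le> enat (nat 2)"
    by (rule P1_le_block_color[where d = 1 and u = "\<lambda>x y z. x + y + z"]) auto
  then show "P1 1 1 1 2 2 2 \<le> 2"
    by (simp add: numeral_eq_enat)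
  have "2 \<le> n" if col: "proper_root_coloring 1 1 1 n \<kappa>" for n \<kappa>
    using proper_root_coloring_neq[OF col, of 0 1 0 0 0 0]
      proper_root_coloring_range[OF col, of "(0, 0, 0)"]
      proper_root_coloring_range[OF col, of "(1, 0, 0)"]
    by simp
  then show "2 \<le> P1 1 1 1 2 2 2"
    using P1_geI[of 1 1 1 2] by (simp add: numeral_eq_enat)
qed

text \<open>Each row repeats with period 6, and neighbouring rows are shifted by half of that.
  Contacts within a row give distance 2, contacts between rows give \<open>3\<close> up to an error
  of 1, all within \<open>{2..4}\<close>.\<close>

lemma P1_211: "P1 2 1 1 6 2 2 = 3"
proof (rule antisym)
  have "P1 2 1 1 6 2 2 \<le> enat (nat 3)"
  proof (rule P1_le_block_color[where d = 2 and u = "\<lambda>x y z. x + 3 * ((y + z) mod 2)"])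
    fix x y z :: int
    have "(y + 2 + z) mod 2 = (y + z) mod 2" "(y + (z + 2)) mod 2 = (y + z) mod 2"
      by presburger+
    then show "3 * 2 dvd x + 6 + 3 * ((y + z) mod 2) - (x + 3 * ((y + z) mod 2))"
      "3 * 2 dvd x + 3 * ((y + 2 + z) mod 2) - (x + 3 * ((y + z) mod 2))"
      "3 * 2 dvd x + 3 * ((y + (z + 2)) mod 2) - (x + 3 * ((y + z) mod 2))"
      by simp_all
  next
    fix x y z x' y' z' :: int
    have key: "\<bar>p + 3 * q - (p' + 3 * q')\<bar> \<in> {2..3 * 2 - 2}"
      if "\<bar>p - p'\<bar> < 2" "\<bar>q - q'\<bar> = 1" for p q p' q' :: int
      using that unfolding atLeastAtMost_iff by linarith
    show "\<bar>x + 3 * ((y + z) mod 2) - (x' + 3 * ((y' + z') mod 2))\<bar> \<in> {2..3 * 2 - 2}"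
      if "\<bar>x - x'\<bar> = 2" "\<bar>y - y'\<bar> < 1" "\<bar>z - z'\<bar> < 1"
      using that by simp
    show "\<bar>x + 3 * ((y + z) mod 2) - (x' + 3 * ((y' + z') mod 2))\<bar> \<in> {2..3 * 2 - 2}"
      if "\<bar>x - x'\<bar> < 2" "\<bar>y - y'\<bar> = 1" "\<bar>z - z'\<bar> < 1"
      using that by (intro key add_parity_shift) auto
    show "\<bar>x + 3 * ((y + z) mod 2) - (x' + 3 * ((y' + z') mod 2))\<bar> \<in> {2..3 * 2 - 2}"
      if "\<bar>x - x'\<bar> < 2" "\<bar>y - y'\<bar> < 1" "\<bar>z - z'\<bar> = 1"
      using that by (intro key add_parity_shift) auto
  qed simp_all
  then show "P1 2 1 1 6 2 2 \<le> 3"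
    by (simp add: numeral_eq_enat)
  have "3 \<le> n" if col: "proper_root_coloring 2 1 1 n \<kappa>" for n \<kappa>
    \<comment> \<open>The triangle: two consecutive bricks of a row and the brick of the next row
      that straddles their joint.\<close>
    using proper_root_coloring_neq[OF col, of 0 2 0 0 0 0]
      proper_root_coloring_neq[OF col, of 0 1 0 1 0 0]
      proper_root_coloring_neq[OF col, of 2 1 0 1 0 0]
      proper_root_coloring_range[OF col, of "(0, 0, 0)"]
      proper_root_coloring_range[OF col, of "(2, 0, 0)"]
      proper_root_coloring_range[OF col, of "(1, 1, 0)"]
    by simp
  then show "3 \<le> P1 2 1 1 6 2 2"
    using P1_geI[of 2 1 1 3] by (simp add: numeral_eq_enat)
qed

text \<open>With three colors, two differently colored roots leave a single color for all their
  common neighbours. This makes consecutive roots of a row agree, although the roots at 0 and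
  \<open>a\<close> touch.\<close>

lemma four_le_of_proper_root_coloring_a11:
  assumes a: "a \<ge> 3" and col: "proper_root_coloring a 1 1 n \<kappa>"
  shows "4 \<le> n"
proof (rule ccontr)
  assume "\<not> 4 \<le> n"
  then have r: "1 \<le> \<kappa> p \<and> \<kappa> p \<le> 3" for p
    using proper_root_coloring_range[OF col, of p] by linarith
  have row: "\<kappa> (x, y, 0) \<noteq> \<kappa> (x + a, y, 0)" for x y
    using a by (intro proper_root_coloring_neq[OF col]) auto
  have next_row: "\<kappa> (x, 0, 0) \<noteq> \<kappa> (x', 1, 0)" if "\<bar>x - x'\<bar> < a" for x x'
    using a that by (intro proper_root_coloring_neq[OF col]) auto
  (* Both roots x and x+1 touch the two differently colored roots x+2-a and x+2 of the next row. *)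
  have step: "\<kappa> (x + 1, 0, 0) = \<kappa> (x, 0, 0)" for x
  proof -
    have "\<kappa> (x + 2 - a, 1, 0) \<noteq> \<kappa> (x + 2, 1, 0)"
      using row[of "x + 2 - a" 1] by simp
    \<comment> \<open>The offsets are \<open>a - 2\<close>, \<open>2\<close>, \<open>a - 1\<close>
      and \<open>1\<close>; that \<open>2\<close> lies below \<open>a\<close> is exactly
      \<open>a \<ge> 3\<close>.\<close>
    moreover have "\<kappa> (x, 0, 0) \<noteq> \<kappa> (x + 2 - a, 1, 0)" "\<kappa> (x, 0, 0) \<noteq> \<kappa> (x + 2, 1, 0)"
      "\<kappa> (x + 1, 0, 0) \<noteq> \<kappa> (x + 2 - a, 1, 0)" "\<kappa> (x + 1, 0, 0) \<noteq> \<kappa> (x + 2, 1, 0)"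
      using a by (intro next_row; linarith)+
    ultimately show ?thesis
      using r[of "(x, 0, 0)"] r[of "(x + 1, 0, 0)"] r[of "(x + 2 - a, 1, 0)"]
        r[of "(x + 2, 1, 0)"] by linarith
  qed
  have "\<kappa> (int k, 0, 0) = \<kappa> (0, 0, 0)" for k
    by (induction k) (use step in \<open>simp_all add: add.commute[of 1]\<close>)
  from this[of "nat a"] show False
    using row[of 0 0] a by simp
qed

text \<open>Two parities, of \<open>x div a\<close> and of \<open>y + z\<close>, serve as the binary
  digits of a color. Every contact changes one of them.\<close>

lemma P1_a11:
  assumes a: "a \<ge> 3"
  shows "P1 a 1 1 (2 * a) 2 2 = 4"
proof (rule antisym)
  define u where "u = (\<lambda>x y z. (x div a) mod 2 + 2 * ((y + z) mod 2))"
  have "P1 a 1 1 (2 * a) 2 2 \<le> enat (nat 4)"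
  proof (rule P1_le_block_color[where d = 1 and u = u])
    fix x y z x' y' z' :: int
    show "\<bar>u x y z - u x' y' z'\<bar> \<in> {1..4 * 1 - 1}"
      if "\<bar>x - x'\<bar> = a" "\<bar>y - y'\<bar> < 1" "\<bar>z - z'\<bar> < 1"
    proof -
      have "(x div a) mod 2 \<noteq> (x' div a) mod 2"
        using that a by (intro div_parity_shift) auto
      moreover have "y' = y" "z' = z"
        using that by auto
      ultimately show ?thesis
        using mod_2_cases[of "x div a"] mod_2_cases[of "x' div a"] by (auto simp: u_def)
    qed
    have s: "\<bar>(x div a) mod 2 - (x' div a) mod 2\<bar> \<le> 1"
      using mod_2_cases[of "x div a"] mod_2_cases[of "x' div a"] by auto
    have key: "\<bar>p + 2 * q - (p' + 2 * q')\<bar> \<in> {1..4 * 1 - 1}"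
      if "\<bar>p - p'\<bar> \<le> 1" "\<bar>q - q'\<bar> = 1" for p q p' q' :: int
      using that unfolding atLeastAtMost_iff by linarith
    show "\<bar>u x y z - u x' y' z'\<bar> \<in> {1..4 * 1 - 1}"
      if "\<bar>x - x'\<bar> < a" "\<bar>y - y'\<bar> = 1" "\<bar>z - z'\<bar> < 1"
      unfolding u_def using s that by (intro key add_parity_shift) auto
    show "\<bar>u x y z - u x' y' z'\<bar> \<in> {1..4 * 1 - 1}"
      if "\<bar>x - x'\<bar> < a" "\<bar>y - y'\<bar> < 1" "\<bar>z - z'\<bar> = 1"
      unfolding u_def using s that by (intro key add_parity_shift) auto
    have "(y + 2 + z) mod 2 = (y + z) mod 2" "(y + (z + 2)) mod 2 = (y + z) mod 2"
      by presburger+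
    then show "4 * 1 dvd u (x + 2 * a) y z - u x y z" "4 * 1 dvd u x (y + 2) z - u x y z"
      "4 * 1 dvd u x y (z + 2) - u x y z"
      using a by (simp_all add: u_def div_parity_period)
  qed (use a in auto)
  then show "P1 a 1 1 (2 * a) 2 2 \<le> 4"
    by (simp add: numeral_eq_enat)
  show "4 \<le> P1 a 1 1 (2 * a) 2 2"
    using P1_geI[of a 1 1 4] four_le_of_proper_root_coloring_a11[OF a]
    by (simp add: numeral_eq_enat)
qed

text \<open>The middle roots of the three rows have three different colors. With four colors, each
  end of a row has the color of its own middle or the fourth color; the two ends differ, so one of
  them has the fourth. Among three rows, two have it at the same end, where they touch.\<close>

lemma five_le_of_proper_root_coloring_221:
  assumes col: "proper_root_coloring 2 2 1 n \<kappa>"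
  shows "5 \<le> n"
proof (rule ccontr)
  assume "\<not> 5 \<le> n"
  then have r: "\<kappa> p \<in> {1, 2, 3, 4}" for p
    using proper_root_coloring_range[OF col, of p] by auto
  \<comment> \<open>\<open>?s\<close> and \<open>?t\<close> are adjacent rows of one layer, and
    \<open>?m\<close> lies in the next layer across their joint, so any two of the three rows are in
    contact.\<close>
  let ?s = "\<lambda>x. \<kappa> (x, 0, 0)" and ?m = "\<lambda>x. \<kappa> (x, 1, 1)" and ?t = "\<lambda>x. \<kappa> (x, 2, 0)"
  have row: "\<kappa> (0, y, z) \<noteq> \<kappa> (2, y, z)" for y z
    by (intro proper_root_coloring_neq[OF col]) auto
  have st: "?s x \<noteq> ?t x'" and sm: "?s x \<noteq> ?m x'" and tm: "?t x \<noteq> ?m x'"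
    if "\<bar>x - x'\<bar> < 2" for x x'
    using that by (intro proper_root_coloring_neq[OF col]; simp)+
  have "?s 0 \<noteq> ?s 2" "?m 0 \<noteq> ?m 2" "?t 0 \<noteq> ?t 2"
    by (rule row)+
  moreover have "?s 0 \<noteq> ?t 0" "?s 0 \<noteq> ?t 1" "?s 1 \<noteq> ?t 0" "?s 1 \<noteq> ?t 1" "?s 1 \<noteq> ?t 2"
    "?s 2 \<noteq> ?t 1" "?s 2 \<noteq> ?t 2"
    by (simp_all add: st)
  moreover have "?s 0 \<noteq> ?m 0" "?s 0 \<noteq> ?m 1" "?s 1 \<noteq> ?m 0" "?s 1 \<noteq> ?m 1" "?s 1 \<noteq> ?m 2"
    "?s 2 \<noteq> ?m 1" "?s 2 \<noteq> ?m 2"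
    by (simp_all add: sm)
  moreover have "?t 0 \<noteq> ?m 0" "?t 0 \<noteq> ?m 1" "?t 1 \<noteq> ?m 0" "?t 1 \<noteq> ?m 1" "?t 1 \<noteq> ?m 2"
    "?t 2 \<noteq> ?m 1" "?t 2 \<noteq> ?m 2"
    by (simp_all add: tm)
  ultimately show False
    using r[of "(0, 0, 0)"] r[of "(1, 0, 0)"] r[of "(2, 0, 0)"] r[of "(0, 1, 1)"]
      r[of "(1, 1, 1)"] r[of "(2, 1, 1)"] r[of "(0, 2, 0)"] r[of "(1, 2, 0)"] r[of "(2, 2, 0)"]
    unfolding insert_iff empty_iff by (smt (verit))
qed

lemma P1_221: "P1 2 2 1 10 10 2 = 5"
proof (rule antisym)
  \<comment> \<open>Strips of width two in the \<open>y\<close> direction are shifted by 4 from one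
    to the next. Odd layers have their strips offset by one, so that between layers the strip
    indices differ in only two ways instead of three.\<close>
  define u where "u = (\<lambda>x y z :: int. x + 4 * ((y - z mod 2) div 2) + 7 * (z mod 2))"
  have "P1 2 2 1 10 10 2 \<le> enat (nat 5)"
  proof (rule P1_le_block_color[where d = 2 and u = u])
    fix x y z x' y' z' :: int
    have same_layer: "u x y z - u x' y' z' =
        (x - x') + 4 * ((y - z mod 2) div 2 - (y' - z mod 2) div 2)" if "\<bar>z - z'\<bar> < 1"
      using that by (simp add: u_def)
    show "\<bar>u x y z - u x' y' z'\<bar> \<in> {2..5 * 2 - 2}"
      if h: "\<bar>x - x'\<bar> = 2" "\<bar>y - y'\<bar> < 2" "\<bar>z - z'\<bar> < 1"
    proof -
      have q: "(y - t) div 2 - (y' - t) div 2 \<in> {-1, 0, 1}" for t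
        using h(2) unfolding insert_iff empty_iff by presburger
      have "\<bar>p + 4 * q\<bar> \<in> {2..5 * 2 - 2}" if "\<bar>p\<bar> = 2" "q \<in> {-1, 0, 1}" for p q :: int
        using that by auto
      from this[OF h(1) q[of "z mod 2"]] show ?thesis
        by (simp only: same_layer[OF h(3)])
    qed
    show "\<bar>u x y z - u x' y' z'\<bar> \<in> {2..5 * 2 - 2}"
      if h: "\<bar>x - x'\<bar> < 2" "\<bar>y - y'\<bar> = 2" "\<bar>z - z'\<bar> < 1"
    proof -
      have q: "\<bar>(y - t) div 2 - (y' - t) div 2\<bar> = 1" for t
        using h(2) by presburger
      have "\<bar>p + 4 * q\<bar> \<in> {2..5 * 2 - 2}" if "\<bar>p\<bar> < 2" "\<bar>q\<bar> = 1" for p q :: int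
        using that by auto
      from this[OF h(1) q[of "z mod 2"]] show ?thesis
        by (simp only: same_layer[OF h(3)])
    qed
    show "\<bar>u x y z - u x' y' z'\<bar> \<in> {2..5 * 2 - 2}"
      if h: "\<bar>x - x'\<bar> < 2" "\<bar>y - y'\<bar> < 2" "\<bar>z - z'\<bar> = 1"
    proof -
      have "z mod 2 = 0 \<and> z' mod 2 = 1 \<or> z mod 2 = 1 \<and> z' mod 2 = 0"
        using h(3) by presburger
      then have "u x y z - u x' y' z' = (x - x') + 4 * (y div 2 - (y' - 1) div 2) - 7 \<or>
          u x y z - u x' y' z' = (x - x') - 4 * (y' div 2 - (y - 1) div 2) + 7"
        by (elim disjE) (simp_all add: u_def)
      moreover have q: "y div 2 - (y' - 1) div 2 \<in> {0, 1}" "y' div 2 - (y - 1) div 2 \<in> {0, 1}"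
        using h(2) unfolding insert_iff empty_iff by presburger+
      \<comment> \<open>The constant 7 fits because both \<open>7\<close> and
        \<open>7 - 4 = 3\<close> stay within \<open>{2..8}\<close> under an error of 1.\<close>
      have far: "\<bar>p + 4 * q - 7\<bar> \<in> {2..5 * 2 - 2}" "\<bar>p - 4 * q + 7\<bar> \<in> {2..5 * 2 - 2}"
        if "\<bar>p\<bar> < 2" "q \<in> {0, 1}" for p q :: int
        using that by auto
      ultimately show ?thesis
        by (elim disjE) (simp_all only: far(1)[OF h(1) q(1)] far(2)[OF h(1) q(2)])
    qed
    show "5 * 2 dvd u (x + 10) y z - u x y z" "5 * 2 dvd u x (y + 10) z - u x y z"
      "5 * 2 dvd u x y (z + 2) - u x y z"
    proof -
      \<comment> \<open>Five strips shift \<open>u\<close> by 20, a multiple of 10.\<close>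
      have "(y + 10 - t) div 2 = (y - t) div 2 + 5" for t
        by presburger
      then show "5 * 2 dvd u (x + 10) y z - u x y z" "5 * 2 dvd u x (y + 10) z - u x y z"
        "5 * 2 dvd u x y (z + 2) - u x y z"
        by (simp_all add: u_def)
    qed
  qed auto
  then show "P1 2 2 1 10 10 2 \<le> 5"
    by (simp add: numeral_eq_enat)
  show "5 \<le> P1 2 2 1 10 10 2"
    using P1_geI[of 2 2 1 5] five_le_of_proper_root_coloring_221 by (simp add: numeral_eq_enat)
qed

(* The four shifts 0, m, 2m, 3m, m = 2b - 1, index the pairs of parities of x div a and z;
   P * b >= 4 * m lets them stay far enough apart modulo P * b. *)
lemma P1_ab1_le:
  assumes a: "a \<ge> 1" and b: "b \<ge> 1" and P: "8 * b - 4 \<le> P * b"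
  shows "P1 a b 1 (2 * a) (P * b) 2 \<le> enat (nat P)"
proof -
  define u where "u = (\<lambda>x y z :: int. y + (2 * b - 1) * (2 * ((x div a) mod 2) + z mod 2))"
  have "P * b > 0"
    using P b by linarith
  then have P0: "P > 0"
    using b by (simp add: zero_less_mult_iff)
  show ?thesis
  proof (rule P1_le_block_color[where d = b and u = u])
    fix x y z x' y' z' :: int
    have u_diff: "u x y z - u x' y' z' =
        (y - y') + (2 * b - 1) * (2 * ((x div a) mod 2 - (x' div a) mod 2) + (z mod 2 - z' mod 2))"
      by (simp add: u_def algebra_simps)
    have s: "(x div a) mod 2 - (x' div a) mod 2 \<in> {-1, 0, 1}"
      using mod_2_cases[of "x div a"] mod_2_cases[of "x' div a"] by auto
    \<comment> \<open>Both ends are tight: \<open>(2 * b - 1) - (b - 1) = b\<close> dictates the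
      multiplier, and \<open>3 * (2 * b - 1) + (b - 1) \<le> P * b - b\<close> is the assumption
      \<open>P\<close>.\<close>
    have dist_less: "\<bar>w + (2 * b - 1) * k\<bar> \<in> {b..P * b - b}"
      if "\<bar>w\<bar> < b" "k \<in> {-3, -2, -1, 1, 2, 3}" for w k
    proof -
      have "2 * b - 1 \<le> \<bar>(2 * b - 1) * k\<bar> \<and> \<bar>(2 * b - 1) * k\<bar> \<le> 6 * b - 3"
        using that(2) b by auto
      then show ?thesis
        using that(1) b P unfolding atLeastAtMost_iff by linarith
    qed
    \<comment> \<open>A contact along \<open>y\<close> fixes \<open>z\<close>, so \<open>k\<close>
      is even. Odd \<open>k\<close> would fail: \<open>w = - b\<close> and \<open>k = 1\<close> give
      only \<open>b - 1\<close>.\<close>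
    have dist_eq: "\<bar>w + (2 * b - 1) * k\<bar> \<in> {b..P * b - b}"
      if "\<bar>w\<bar> = b" "k \<in> {-2, 0, 2}" for w k
    proof -
      have "(2 * b - 1) * k = 0 \<or> \<bar>(2 * b - 1) * k\<bar> = 4 * b - 2"
        using that(2) b by auto
      then show ?thesis
        using that(1) b P unfolding atLeastAtMost_iff by linarith
    qed
    show "\<bar>u x y z - u x' y' z'\<bar> \<in> {b..P * b - b}"
      if h: "\<bar>x - x'\<bar> = a" "\<bar>y - y'\<bar> < b" "\<bar>z - z'\<bar> < 1"
    proof -
      have "(x div a) mod 2 \<noteq> (x' div a) mod 2"
        using h a by (intro div_parity_shift) auto
      then show ?thesis
        unfolding u_diff using s h by (intro dist_less) auto
    qed
    show "\<bar>u x y z - u x' y' z'\<bar> \<in> {b..P * b - b}"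
      if h: "\<bar>x - x'\<bar> < a" "\<bar>y - y'\<bar> = b" "\<bar>z - z'\<bar> < 1"
      unfolding u_diff using s h by (intro dist_eq) auto
    show "\<bar>u x y z - u x' y' z'\<bar> \<in> {b..P * b - b}"
      if h: "\<bar>x - x'\<bar> < a" "\<bar>y - y'\<bar> < b" "\<bar>z - z'\<bar> = 1"
    proof -
      have "z mod 2 - z' mod 2 \<in> {-1, 1}"
        using h(3) unfolding insert_iff empty_iff by presburger
      moreover have "2 * p + q \<in> {-3, -2, -1, 1, 2, 3}"
        if "p \<in> {-1, 0, 1}" "q \<in> {-1, 1}" for p q :: int
        using that by auto
      ultimately show ?thesis
        unfolding u_diff using s h(2) by (intro dist_less)
    qed
    show "P * b dvd u (x + 2 * a) y z - u x y z" "P * b dvd u x (y + P * b) z - u x y z"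
      "P * b dvd u x y (z + 2) - u x y z"
      using a by (simp_all add: u_def div_parity_period)
  qed (use a b P0 in auto)
qed

text \<open>The three block parities are the binary digits of a number below 8, and a contact along
  an axis flips the digit of that axis.\<close>

lemma P1_abc_le_8:
  assumes abc: "a \<ge> 1" "b \<ge> 1" "c \<ge> 1"
  shows "P1 a b c (2 * a) (2 * b) (2 * c) \<le> 8"
proof -
  define u where
    "u = (\<lambda>x y z. (x div a) mod 2 + 2 * ((y div b) mod 2) + 4 * ((z div c) mod 2))"
  have dist: "\<bar>u x y z - u x' y' z'\<bar> \<in> {1..8 * 1 - 1}"
    if "(x div a) mod 2 \<noteq> (x' div a) mod 2 \<or> (y div b) mod 2 \<noteq> (y' div b) mod 2 \<or>
      (z div c) mod 2 \<noteq> (z' div c) mod 2" for x y z x' y' z'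
  proof -
    have diff: "k mod 2 - l mod 2 \<in> {-1, 0, 1}" for k l :: int
      using mod_2_cases[of k] mod_2_cases[of l] by auto
    have "\<bar>p + 2 * q + 4 * r\<bar> \<in> {1..7}"
      if "p \<in> {-1, 0, 1}" "q \<in> {-1, 0, 1}" "r \<in> {-1, 0, 1}" "p \<noteq> 0 \<or> q \<noteq> 0 \<or> r \<noteq> 0"
      for p q r :: int
      using that by auto
    from this[OF diff[of "x div a" "x' div a"] diff[of "y div b" "y' div b"]
        diff[of "z div c" "z' div c"]]
    show ?thesis
      using that by (simp add: u_def algebra_simps)
  qed
  have "P1 a b c (2 * a) (2 * b) (2 * c) \<le> enat (nat 8)"
  proof (rule P1_le_block_color[where d = 1 and u = u])
    fix x y z x' y' z' :: int
    show "\<bar>u x y z - u x' y' z'\<bar> \<in> {1..8 * 1 - 1}" if "\<bar>x - x'\<bar> = a"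
      using that abc by (intro dist) (simp add: div_parity_shift)
    show "\<bar>u x y z - u x' y' z'\<bar> \<in> {1..8 * 1 - 1}" if "\<bar>y - y'\<bar> = b"
      using that abc by (intro dist) (simp add: div_parity_shift)
    show "\<bar>u x y z - u x' y' z'\<bar> \<in> {1..8 * 1 - 1}" if "\<bar>z - z'\<bar> = c"
      using that abc by (intro dist) (simp add: div_parity_shift)
  qed (use abc in \<open>simp_all add: u_def div_parity_period\<close>)
  then show ?thesis
    by (simp add: numeral_eq_enat)
qed

theorem theorem3p3:
  shows "(chi1 1 1 1 \<le> P1 1 1 1 2 2 2 \<and> P1 1 1 1 2 2 2 = 2) \<and>
    (chi1 2 1 1 \<le> P1 2 1 1 6 2 2 \<and> P1 2 1 1 6 2 2 = 3) \<and>
    (\<forall>a::int. a \<ge> 3 \<longrightarrow> chi1 a 1 1 \<le> P1 a 1 1 (2*a) 2 2 \<and> P1 a 1 1 (2*a) 2 2 = 4) \<and>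
    (chi1 2 2 1 \<le> P1 2 2 1 10 10 2 \<and> P1 2 2 1 10 10 2 = 5) \<and>
    (\<forall>a::int. a \<ge> 3 \<longrightarrow> chi1 a 2 1 \<le> P1 a 2 1 (2*a) 12 2 \<and> P1 a 2 1 (2*a) 12 2 \<le> 6) \<and>
    (\<forall>a::int. a \<ge> 3 \<longrightarrow> chi1 a 3 1 \<le> P1 a 3 1 (2*a) 21 2 \<and> P1 a 3 1 (2*a) 21 2 \<le> 7) \<and>
    (\<forall>a::int. a \<ge> 4 \<longrightarrow> chi1 a 4 1 \<le> P1 a 4 1 (2*a) 28 2 \<and> P1 a 4 1 (2*a) 28 2 \<le> 7) \<and>
    (\<forall>a b c::int. a \<ge> b \<and> b \<ge> c \<and> c \<ge> 1 \<longrightarrow>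
       chi1 a b c \<le> P1 a b c (2*a) (2*b) (2*c) \<and> P1 a b c (2*a) (2*b) (2*c) \<le> 8)"
proof (intro conjI allI impI)
  show "P1 1 1 1 2 2 2 = 2" "P1 2 1 1 6 2 2 = 3" "P1 2 2 1 10 10 2 = 5"
    by (fact P1_111 P1_211 P1_221)+
  show "P1 a 1 1 (2 * a) 2 2 = 4" if "3 \<le> a" for a
    using that by (rule P1_a11)
  \<comment> \<open>Here and in the next two cases \<open>P\<close> is the least integer with
    \<open>8 * b - 4 \<le> P * b\<close>: the instances read \<open>12 \<le> 12\<close>,
    \<open>20 \<le> 21\<close> and \<open>28 \<le> 28\<close>. From \<open>b = 5\<close> on, that
    least integer is 8.\<close>
  show "P1 a 2 1 (2 * a) 12 2 \<le> 6" if "3 \<le> a" for a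
    using P1_ab1_le[of a 2 6] that by (simp add: numeral_eq_enat)
  show "P1 a 3 1 (2 * a) 21 2 \<le> 7" if "3 \<le> a" for a
    using P1_ab1_le[of a 3 7] that by (simp add: numeral_eq_enat)
  show "P1 a 4 1 (2 * a) 28 2 \<le> 7" if "4 \<le> a" for a
    using P1_ab1_le[of a 4 7] that by (simp add: numeral_eq_enat)
  show "P1 a b c (2 * a) (2 * b) (2 * c) \<le> 8" if "b \<le> a \<and> c \<le> b \<and> 1 \<le> c" for a b c
    using that by (intro P1_abc_le_8) auto
qed (auto intro!: chi1_le_P1)

end
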